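(* Let $n, m$ be positive integers, let $k \ge 0$ be an integer, and let $B = \{0 \le b_m \le b_{m-1} \le \ldots \le b_1 \le n-1\}$ be a sequence of $m$ integers. Then Algorithm 2 under input $B$ yields a minimum partition of $B$ into $k$-large subsequences: its output $B_1, B_2, \ldots, B_t$ is a partition of $B$ into $t$ $k$-large subsequences, and $t$ is the minimum number of $k$-large subsequences into which $B$ can be partitioned.
   Context: Fix positive integers $n,m$ and an integer $k\ge 0$. A sequence $B = \{0 \le b_m \le b_{m-1} \le \ldots \le b_1 \le n-1\}$ consists of $m$ integers (repetitions allowed; entries are distinguished by their indices, and $|\cdot|$ counts entries with multiplicity). A subsequence $B'$ of $B$ is called $k$-large if every member $x$ of $B'$ satisfies $x \ge |B'| - k - 1$. Algorithm 2 (input $B$): Set $i := 0$ and $S_0 := B$. Repeat the following until $S_i = \emptyset$: (1) $n_i := |S_i|$; (2) $q_i := \min\{n_i,\, b_{n_i} + k + 1\}$; (3) $B_{i+1} := \{b_{n_i}, b_{n_i - 1}, \ldots, b_{n_i - q_i + 1}\}$; (4) $S_{i+1} := S_i \setminus B_{i+1}$; (5) $i := i+1$. Output: $t := i$ and $B_1, B_2, \ldots, B_t$. (Thus each $S_i$ consists of the entries $b_1, \ldots, b_{n_i}$.) *)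

theory Defs
  imports Main "HOL-Library.Disjoint_Sets" "HOL-Library.While_Combinator"
begin

text \<open>
  The sequence \<open>b\<^sub>m \<le> \<dots> \<le> b\<^sub>1\<close> is a function \<open>b\<close> on the indices \<open>{1..m}\<close>. Entries are
  distinguished by their indices, so a subsequence is represented by its set of indices,
  and its length counted with multiplicity is the cardinality of that set.
\<close>

definition k_large :: "nat \<Rightarrow> (nat \<Rightarrow> int) \<Rightarrow> nat set \<Rightarrow> bool" where
  "k_large k b I \<longleftrightarrow> (\<forall>j\<in>I. b j \<ge> int (card I) - int k - 1)"

definition k_large_partition :: "nat \<Rightarrow> nat \<Rightarrow> (nat \<Rightarrow> int) \<Rightarrow> nat set set \<Rightarrow> bool" where
  "k_large_partition k m b P \<longleftrightarrow> partition_on {1..m} P \<and> (\<forall>I\<in>P. k_large k b I)"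

text \<open>
  The state \<open>(i, S, Bs)\<close> consists of \<open>i\<close>, \<open>S\<^sub>i\<close> and the list of \<open>B\<^sub>1, \<dots>, B\<^sub>i\<close>. Since
  \<open>q\<^sub>i \<le> n\<^sub>i\<close>, the subtraction on \<^typ>\<open>nat\<close> is never truncated; the conversion \<^term>\<open>nat\<close> does
  not truncate either, as long as the entries are non-negative.
\<close>

definition algorithm2_step ::
    "nat \<Rightarrow> (nat \<Rightarrow> int) \<Rightarrow> nat \<times> nat set \<times> nat set list \<Rightarrow> nat \<times> nat set \<times> nat set list" where
  "algorithm2_step k b = (\<lambda>(i, S, Bs).
     let n\<^sub>i = card S;
         q\<^sub>i = nat (min (int n\<^sub>i) (b n\<^sub>i + int k + 1));
         B' = {n\<^sub>i - q\<^sub>i + 1..n\<^sub>i}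
     in (i + 1, S - B', Bs @ [B']))"

text \<open>The result is \<^term>\<open>None\<close> iff the loop does not terminate, and else \<open>(t, [B\<^sub>1, \<dots>, B\<^sub>t])\<close>.\<close>

definition algorithm2 :: "nat \<Rightarrow> nat \<Rightarrow> (nat \<Rightarrow> int) \<Rightarrow> (nat \<times> nat set list) option" where
  "algorithm2 k m b =
     map_option (\<lambda>(i, S, Bs). (i, Bs))
       (while_option (\<lambda>(i, S, Bs). S \<noteq> {}) (algorithm2_step k b) (0, {1..m}, []))"

end

theory Submission imports Defs begin

text \<open>
  Optimality is a loop invariant: after \<open>i\<close> rounds, when the entries \<open>b\<^sub>1, \<dots>, b\<^sub>r\<close> remain, any
  \<open>k\<close>-large partition \<open>P\<close> can be deprived of \<open>i\<close> of its parts so that the others still contain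
  at least \<open>r\<close> entries. In the next round one removes the part \<open>I\<close> of the largest remaining
  index \<open>x\<close>. There are at least \<open>r\<close> remaining indices, so \<open>x \<ge> r\<close>; hence \<open>b\<^sub>x \<le> b\<^sub>r\<close> and
  \<open>|I| \<le> b\<^sub>r + k + 1\<close>, so \<open>I\<close> is no larger than the block that the algorithm takes unless that
  block is everything that is left.
\<close>

text \<open>This is the \<open>q\<^sub>i\<close> of the algorithm, as a function of the number
  \<open>r\<close> of entries that remain.\<close>

definition greedy_size :: "nat \<Rightarrow> (nat \<Rightarrow> int) \<Rightarrow> nat \<Rightarrow> nat" where
  "greedy_size k b r = nat (min (int r) (b r + int k + 1))"

lemma greedy_size_le: "greedy_size k b r \<le> r"
  by (simp add: greedy_size_def)

lemma greedy_size_pos: "0 < greedy_size k b r" if "1 \<le> r" "0 \<le> b r"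
  using that by (simp add: greedy_size_def)

lemma algorithm2_step_eq:
  "algorithm2_step k b (i, {1..r}, Bs) =
     (i + 1, {1..r - greedy_size k b r}, Bs @ [{r - greedy_size k b r + 1..r}])"
  using greedy_size_le[of k b r] by (auto simp: algorithm2_step_def greedy_size_def Let_def)

lemma card_le_Max_of_pos:
  assumes "finite A" "A \<noteq> {}" "0 \<notin> A"
  shows "card A \<le> Max A"
proof -
  have "A \<subseteq> {1..Max A}"
    using assms by (auto simp: Suc_le_eq intro: gr0I)
  then show ?thesis
    using card_mono[of "{1..Max A}" A] by simp
qed

text \<open>By monotonicity \<open>b r\<close> is the smallest entry of the block, and the block
  size was capped at \<open>b r + k + 1\<close>.\<close>

lemma k_large_greedy_block:
  assumes "antimono_on {1..m} b" and "1 \<le> r" "r \<le> m" and "0 \<le> b r"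
  shows "k_large k b {r - greedy_size k b r + 1..r}"
  unfolding k_large_def
proof
  fix j assume j: "j \<in> {r - greedy_size k b r + 1..r}"
  then have "b r \<le> b j"
    using assms(2,3) by (intro monotone_onD[OF assms(1)]) auto
  moreover have "int (card {r - greedy_size k b r + 1..r}) \<le> b r + int k + 1"
    using assms(4) greedy_size_le[of k b r] by (simp add: greedy_size_def)
  ultimately show "b j \<ge> int (card {r - greedy_size k b r + 1..r}) - int k - 1"
    by linarith
qed

lemma remove_part:
  assumes anti: "antimono_on {1..m} b" and r: "1 \<le> r"
    and P: "k_large_partition k m b P"
    and Q: "Q \<subseteq> P" "r \<le> card (\<Union>Q)"
  obtains I where "I \<in> Q" "r - greedy_size k b r \<le> card (\<Union>(Q - {I}))"
proof -
  have sub: "\<Union>Q \<subseteq> {1..m}"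
    using P Q(1) by (auto simp: k_large_partition_def partition_on_def)
  have fin: "finite (\<Union>Q)"
    using sub finite_subset by blast
  have ne: "\<Union>Q \<noteq> {}"
    using Q(2) r by (metis card.empty not_one_le_zero le_trans)
  define x where "x = Max (\<Union>Q)"
  have x: "x \<in> \<Union>Q"
    unfolding x_def using fin ne by (rule Max_in)
  have "0 \<notin> \<Union>Q"
    using sub by auto
  then have "r \<le> x"
    using card_le_Max_of_pos[OF fin ne] Q(2) unfolding x_def by linarith
  then have bx: "b x \<le> b r"
    using x sub r by (intro monotone_onD[OF anti]) auto
  obtain I where I: "I \<in> Q" "x \<in> I"
    using x by blast
  have "k_large k b I"
    using P I(1) Q(1) by (auto simp: k_large_partition_def)
  then have "int (card I) \<le> b r + int k + 1"
    using I(2) bx by (fastforce simp: k_large_def)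
  \<comment> \<open>If the minimum in \<open>greedy_size\<close> is \<open>r\<close>, the left side
    is 0; otherwise it is \<open>b r + k + 1\<close>, which bounds \<open>card I\<close>.\<close>
  then have "r - greedy_size k b r \<le> r - card I"
    unfolding greedy_size_def by linarith
  also have "\<dots> \<le> card (\<Union>Q) - card I"
    using Q(2) by simp
  also have "\<dots> \<le> card (\<Union>Q - I)"
    by (intro diff_card_le_card_Diff) (meson I(1) Union_upper fin finite_subset)
  \<comment> \<open>An entry of \<open>\<Union>Q\<close> outside \<open>I\<close> lies in another
    member of \<open>Q\<close>.\<close>
  also have "\<dots> \<le> card (\<Union>(Q - {I}))"
    by (rule card_mono) (use fin in \<open>auto intro: finite_subset\<close>)
  finally show thesis
    using I(1) that by blast
qed

text \<open>\<open>Q\<close> holds the parts of \<open>P\<close> that survive \<open>i\<close>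
  removals; the additive form \<open>card Q + i = card P\<close> avoids truncated subtraction and so
  yields \<open>i \<le> card P\<close>. Distinctness is recorded because \<open>set Bs\<close> would
  hide a repeated block.\<close>

definition greedy_inv ::
    "nat \<Rightarrow> nat \<Rightarrow> (nat \<Rightarrow> int) \<Rightarrow> nat \<times> nat set \<times> nat set list \<Rightarrow> bool" where
  "greedy_inv k m b = (\<lambda>(i, S, Bs). \<exists>r\<le>m. S = {1..r} \<and> length Bs = i \<and> distinct Bs
     \<and> partition_on {r + 1..m} (set Bs) \<and> (\<forall>I\<in>set Bs. k_large k b I)
     \<and> (\<forall>P. k_large_partition k m b P \<longrightarrow>
          (\<exists>Q\<subseteq>P. card Q + i = card P \<and> r \<le> card (\<Union>Q))))"

text \<open>Nothing has been removed yet: take \<open>r = m\<close> and \<open>Q = P\<close>, which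
  covers \<open>{1..m}\<close>.\<close>

lemma greedy_inv_init: "greedy_inv k m b (0, {1..m}, [])"
  by (auto simp: greedy_inv_def partition_on_empty k_large_partition_def partition_on_def
      intro!: exI[of _ m])

text \<open>The second claim is the termination measure: a non-negative \<open>b r\<close> makes the
  block non-empty.\<close>

lemma greedy_inv_step:
  assumes anti: "antimono_on {1..m} b" and nonneg: "\<forall>j\<in>{1..m}. 0 \<le> b j"
    and inv: "greedy_inv k m b (i, S, Bs)" and S: "S \<noteq> {}"
  shows "greedy_inv k m b (algorithm2_step k b (i, S, Bs))"
    and "card (fst (snd (algorithm2_step k b (i, S, Bs)))) < card S"
proof -
  obtain r where r: "r \<le> m" "S = {1..r}" and Bs: "length Bs = i" "distinct Bs"
      "partition_on {r + 1..m} (set Bs)" "\<forall>I\<in>set Bs. k_large k b I"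
    and opt: "\<And>P. k_large_partition k m b P \<Longrightarrow>
      \<exists>Q\<subseteq>P. card Q + i = card P \<and> r \<le> card (\<Union>Q)"
    using inv unfolding greedy_inv_def by auto
  have r1: "1 \<le> r"
    using S r(2) by auto
  have br: "0 \<le> b r"
    using nonneg r1 r(1) by auto
  define q where "q = greedy_size k b r"
  define B' where "B' = {r - q + 1..r}"
  have q: "0 < q" "q \<le> r"
    unfolding q_def using greedy_size_pos[where b = b, OF r1 br] greedy_size_le by auto
  have step: "algorithm2_step k b (i, S, Bs) = (i + 1, {1..r - q}, Bs @ [B'])"
    unfolding r(2) B'_def q_def by (rule algorithm2_step_eq)
  have B': "B' \<noteq> {}" "disjnt B' {r + 1..m}"
    using q by (auto simp: B'_def disjnt_def)
  have "\<Union>(set Bs) = {r + 1..m}"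
    using Bs(3) by (simp add: partition_on_def)
  moreover have "{r - q + 1..m} - B' = {r + 1..m}" "B' \<subseteq> {r - q + 1..m}"
    using q r(1) by (auto simp: B'_def)
  ultimately have part: "partition_on {r - q + 1..m} (set (Bs @ [B']))"
    using Bs(3) B' by (simp add: partition_on_insert)
  \<comment> \<open>\<open>B'\<close> is non-empty and disjoint from the union of the earlier
    blocks, so it equals none of them.\<close>
  have dist: "distinct (Bs @ [B'])"
    using Bs(2,3) B' by (auto simp: partition_on_def disjnt_def)
  have large: "\<forall>I\<in>set (Bs @ [B']). k_large k b I"
    using Bs(4) k_large_greedy_block[OF anti r1 r(1) br, where k = k]
    by (simp add: B'_def q_def)
  have "\<exists>Q\<subseteq>P. card Q + (i + 1) = card P \<and> r - q \<le> card (\<Union>Q)"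
    if P: "k_large_partition k m b P" for P
  proof -
    obtain Q where Q: "Q \<subseteq> P" "card Q + i = card P" "r \<le> card (\<Union>Q)"
      using opt[OF P] by blast
    obtain I where I: "I \<in> Q" "r - q \<le> card (\<Union>(Q - {I}))"
      using remove_part[where r = r, OF anti r1 P Q(1,3)] unfolding q_def by blast
    have "finite Q"
      using P finite_elements[of "{1..m}" P] finite_subset[OF Q(1)]
      by (simp add: k_large_partition_def)
    then have "card (Q - {I}) + (i + 1) = card P"
      using I(1) Q(2) card_Suc_Diff1[of Q I] by simp
    then show ?thesis
      using I(2) Q(1) by blast
  qed
  then show "greedy_inv k m b (algorithm2_step k b (i, S, Bs))"
    unfolding step greedy_inv_def prod.case
    using r(1) Bs(1) part dist large by (intro exI[of _ "r - q"]) auto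
  show "card (fst (snd (algorithm2_step k b (i, S, Bs)))) < card S"
    unfolding step using q by (simp add: r(2))
qed

text \<open>An empty rest forces \<open>r = 0\<close>, so the blocks cover \<open>{1..m}\<close>;
  the bound on \<open>t\<close> is read off from \<open>card Q + t = card P\<close>.\<close>

lemma greedy_inv_final:
  assumes "greedy_inv k m b (t, {}, Bs)"
  shows "length Bs = t" and "distinct Bs" and "k_large_partition k m b (set Bs)"
    and "k_large_partition k m b P \<Longrightarrow> t \<le> card P"
proof -
  obtain r where r: "{} = {1..r}" "length Bs = t" "distinct Bs"
      "partition_on {r + 1..m} (set Bs)" "\<forall>I\<in>set Bs. k_large k b I"
    and opt: "\<And>P. k_large_partition k m b P \<Longrightarrow>
      \<exists>Q\<subseteq>P. card Q + t = card P \<and> r \<le> card (\<Union>Q)"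
    using assms unfolding greedy_inv_def by auto
  have "r = 0"
    using r(1) by (simp add: Suc_le_eq)
  then show "length Bs = t" "distinct Bs" "k_large_partition k m b (set Bs)"
    using r by (simp_all add: k_large_partition_def)
  show "t \<le> card P" if "k_large_partition k m b P"
    using opt[OF that] by auto
qed

theorem theorem3p4:
  fixes n m k :: nat and b :: "nat \<Rightarrow> int"
  assumes "n \<ge> 1" and "m \<ge> 1"
    and "0 \<le> b m"
    and "\<forall>j\<in>{1..<m}. b (Suc j) \<le> b j"
    and "b 1 \<le> int n - 1"
  shows "\<exists>t Bs. algorithm2 k m b = Some (t, Bs)
    \<and> length Bs = t \<and> distinct Bs \<and> k_large_partition k m b (set Bs)
    \<and> (\<forall>P. k_large_partition k m b P \<longrightarrow> t \<le> card P)"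
proof -
  \<comment> \<open>Induction on \<open>j\<close> extends the comparison of neighbours to all pairs
    of indices.\<close>
  have "b j \<le> b i" if "i \<le> j" "1 \<le> i" "j \<le> m" for i j
    using that
  proof (induction j rule: dec_induct)
    case (step j)
    then have "b (Suc j) \<le> b j"
      using assms(4) by simp
    with step show ?case
      by simp
  qed simp
  then have anti: "antimono_on {1..m} b"
    by (intro monotone_onI) auto
  have nonneg: "\<forall>j\<in>{1..m}. 0 \<le> b j"
    using monotone_onD[OF anti, of _ m] assms(2,3) by fastforce
  let ?c = "\<lambda>(i :: nat, S :: nat set, Bs :: nat set list). S \<noteq> {}"
  let ?s = "(0, {1..m}, [])"
  have step: "greedy_inv k m b (algorithm2_step k b s) \<and>
      card (fst (snd (algorithm2_step k b s))) < card (fst (snd s))"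
    if "greedy_inv k m b s" "?c s" for s
    using that greedy_inv_step[OF anti nonneg] by (cases s) auto
  obtain s where s: "while_option ?c (algorithm2_step k b) ?s = Some s"
    using measure_while_option_Some[of "greedy_inv k m b" ?c "algorithm2_step k b"
        "\<lambda>s. card (fst (snd s))" ?s] step greedy_inv_init by blast
  obtain t S Bs where s_eq: "s = (t, S, Bs)"
    by (cases s)
  have "S = {}"
    using while_option_stop[OF s] by (simp add: s_eq)
  moreover have "greedy_inv k m b s"
    using while_option_rule[where P = "greedy_inv k m b", OF _ s] step greedy_inv_init by blast
  ultimately have inv: "greedy_inv k m b (t, {}, Bs)"
    by (simp add: s_eq)
  have "algorithm2 k m b = Some (t, Bs)"
    unfolding algorithm2_def s by (simp add: s_eq)
  then show ?thesis
    using greedy_inv_final[OF inv] by blast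
qed

end
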